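(* Let $(S_n)_{n\ge 0}$ be an ERWG process with any memory matrix $B$ (not necessarily diagonalisable). Then $$S_n=o\big(n^{\frac12+\delta}\big)\quad\text{a.s.}\qquad\text{for all }\ \delta>\tfrac12-\min\{\tfrac12,\,1-\eta\}.$$
   Context: ERWG model. Let $k\ge1$, $V=\{1,\dots,k\}$, and let $(V,\overrightarrow{E})$, $\overrightarrow{E}\subseteq V\times V$, be a directed graph (self-loops allowed) in which every vertex $j$ has in-degree $d_j^{\rm in}=|\{i:(i,j)\in\overrightarrow{E}\}|\ge1$. Let $p_v,q_v\in[0,1]$ for $v\in V$. $\mathrm{Rad}(p)$ is the law on $\{-1,1\}$ giving mass $p$ to $1$. Let $\{\sigma^{(v)},\xi_n^{(v)},D_n^{(v)},u_n^{(v)}: n\ge1,v\in V\}$ be independent with $\sigma^{(v)}\sim\mathrm{Rad}(q_v)$, $\xi_n^{(v)}\sim\mathrm{Rad}(p_v)$, $D_n^{(v)}\sim\mathrm{Unif}\{1,\dots,n\}$, $u_n^{(v)}\sim\mathrm{Unif}\{v':(v',v)\in\overrightarrow{E}\}$. Define $X_1^{(v)}=\sigma^{(v)}$ and, for $n\ge1$, $X_{n+1}^{(v)}=\xi_n^{(v)}X^{(u_n^{(v)})}_{D_n^{(v)}}$; set $X_n=(X_n^{(1)},\dots,X_n^{(k)})$, $S_0=0$, $S_n=\sum_{j=1}^nX_j$. The process $(S_n)$ is called the ERWG process. Its memory matrix is the $k\times k$ matrix $B$ with $B_{i,j}=\frac{2p_j-1}{d_j^{\rm in}}\mathbf{1}_{\{(i,j)\in\overrightarrow{E}\}}$.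 Let $\lambda_1,\dots,\lambda_k$ be the eigenvalues of $B$ (with multiplicity) and $\eta=\max_j\Re(\lambda_j)$. The $o(\cdot)$ is as $n\to\infty$. *)

theory Defs
  imports
    "HOL-Probability.Probability"
    "HOL-Library.Landau_Symbols"
    "Jordan_Normal_Form.Spectral_Radius"
begin

definition rademacher_pmf :: "real \<Rightarrow> int pmf" where
  "rademacher_pmf p = map_pmf (\<lambda>b. if b then 1 else -1) (bernoulli_pmf p)"

definition in_nbrs :: "(nat \<times> nat) set \<Rightarrow> nat \<Rightarrow> nat set" where
  "in_nbrs E j = {i. (i, j) \<in> E}"

datatype rv_index = Sigma_ix nat | Xi_ix nat nat | D_ix nat nat | U_ix nat nat

text \<open>
  The time index of \<open>\<xi>\<close>, \<open>D\<close>, \<open>u\<close> and \<open>X\<close> comes first and the vertex second.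
  \<^const>\<open>prob_space.indep_vars\<close> needs all variables of the family to have values in one
  type. Hence the variables with values in \<^typ>\<open>nat\<close> are embedded into \<^typ>\<open>int\<close>;
  the embedding is injective and all spaces are discrete, so the generated sigma-algebras,
  and with them the notion of independence, are unchanged.

  The recursion for \<open>X\<close> is required almost surely, since the laws of \<open>D\<close> and \<open>u\<close>
  restrict their values only up to a null set.
\<close>

locale erwg = prob_space M
  for M :: "'a measure" +
  fixes k :: nat
    and E :: "(nat \<times> nat) set"
    and p q :: "nat \<Rightarrow> real"
    and \<sigma> :: "nat \<Rightarrow> 'a \<Rightarrow> int"
    and \<xi> :: "nat \<Rightarrow> nat \<Rightarrow> 'a \<Rightarrow> int"
    and D :: "nat \<Rightarrow> nat \<Rightarrow> 'a \<Rightarrow> nat"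
    and u :: "nat \<Rightarrow> nat \<Rightarrow> 'a \<Rightarrow> nat"
    and X :: "nat \<Rightarrow> nat \<Rightarrow> 'a \<Rightarrow> int"
  assumes k_ge_1: "k \<ge> 1"
    and edges: "E \<subseteq> {1..k} \<times> {1..k}"
    and in_degree: "\<And>j. j \<in> {1..k} \<Longrightarrow> card (in_nbrs E j) \<ge> 1"
    and p_range: "\<And>v. v \<in> {1..k} \<Longrightarrow> p v \<in> {0..1}"
    and q_range: "\<And>v. v \<in> {1..k} \<Longrightarrow> q v \<in> {0..1}"
    and indep: "indep_vars (\<lambda>_. count_space UNIV)
        (\<lambda>ix. case ix of
             Sigma_ix v \<Rightarrow> \<sigma> v
           | Xi_ix n v \<Rightarrow> \<xi> n v
           | D_ix n v \<Rightarrow> (\<lambda>\<omega>. int (D n v \<omega>))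
           | U_ix n v \<Rightarrow> (\<lambda>\<omega>. int (u n v \<omega>)))
        (\<Union>v\<in>{1..k}. \<Union>n\<in>{1..}. {Sigma_ix v, Xi_ix n v, D_ix n v, U_ix n v})"
    and law_sigma: "\<And>v. v \<in> {1..k} \<Longrightarrow>
        distr M (count_space UNIV) (\<sigma> v) = measure_pmf (rademacher_pmf (q v))"
    and law_xi: "\<And>n v. n \<ge> 1 \<Longrightarrow> v \<in> {1..k} \<Longrightarrow>
        distr M (count_space UNIV) (\<xi> n v) = measure_pmf (rademacher_pmf (p v))"
    and law_D: "\<And>n v. n \<ge> 1 \<Longrightarrow> v \<in> {1..k} \<Longrightarrow>
        distr M (count_space UNIV) (D n v) = measure_pmf (pmf_of_set {1..n})"
    and law_u: "\<And>n v. n \<ge> 1 \<Longrightarrow> v \<in> {1..k} \<Longrightarrow>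
        distr M (count_space UNIV) (u n v) = measure_pmf (pmf_of_set (in_nbrs E v))"
    and X_1: "\<And>v. v \<in> {1..k} \<Longrightarrow> AE \<omega> in M. X 1 v \<omega> = \<sigma> v \<omega>"
    and X_Suc: "\<And>n v. n \<ge> 1 \<Longrightarrow> v \<in> {1..k} \<Longrightarrow>
        AE \<omega> in M. X (Suc n) v \<omega> = \<xi> n v \<omega> * X (D n v \<omega>) (u n v \<omega>) \<omega>"

definition walk :: "(nat \<Rightarrow> nat \<Rightarrow> 'a \<Rightarrow> int) \<Rightarrow> nat \<Rightarrow> 'a \<Rightarrow> nat \<Rightarrow> real" where
  "walk X n \<omega> v = (\<Sum>j=1..n. real_of_int (X j v \<omega>))"

text \<open>Matrix indices start at 0, vertices at 1.\<close>

definition memory_mat :: "nat \<Rightarrow> (nat \<times> nat) set \<Rightarrow> (nat \<Rightarrow> real) \<Rightarrow> real mat" where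
  "memory_mat k E p = mat k k (\<lambda>(i, j).
     if (Suc i, Suc j) \<in> E
     then (2 * p (Suc j) - 1) / real (card (in_nbrs E (Suc j))) else 0)"

definition max_Re_eigenvalue :: "real mat \<Rightarrow> real" where
  "max_Re_eigenvalue B = Max (Re ` spectrum (map_mat complex_of_real B))"

lemma spectrum_memory_mat:
  assumes "k \<ge> 1"
  shows "finite (spectrum (map_mat complex_of_real (memory_mat k E p)))"
    and "spectrum (map_mat complex_of_real (memory_mat k E p)) \<noteq> {}"
proof -
  have *: "map_mat complex_of_real (memory_mat k E p) \<in> carrier_mat k k"
    by (simp add: memory_mat_def)
  show "finite (spectrum (map_mat complex_of_real (memory_mat k E p)))"
    by (rule card_finite_spectrum(1)[OF *])
  show "spectrum (map_mat complex_of_real (memory_mat k E p)) \<noteq> {}"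
    using spectrum_non_empty[OF *] assms by simp
qed

end

theory Submission
  imports Defs "Jordan_Normal_Form.Schur_Decomposition" "HOL-Real_Asymp.Real_Asymp"
begin

text \<open>
  Given the first \<open>n\<close> steps, the conditional mean of \<open>X\<^sub>n\<^sub>+\<^sub>1\<close> is the row vector
  \<open>S\<^sub>n B / n\<close>. Hence \<open>S\<^sub>n\<^sub>+\<^sub>1 = S\<^sub>n (I + B / n) + (N\<^sub>n\<^sub>+\<^sub>1 - N\<^sub>n)\<close> for a martingale \<open>N\<close> with
  bounded increments. Hoeffding's lemma and the Borel--Cantelli lemma give
  \<open>N\<^sub>n = O(n\<^sup>\<gamma>)\<close> almost surely for every \<open>\<gamma> > 1/2\<close>. The rest is deterministic: in a basis in
  which \<open>B\<close> is upper triangular, the recursion is solved one coordinate at a time, and each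
  coordinate stays \<open>O(n\<^sup>\<gamma>)\<close> once \<open>\<gamma>\<close> also exceeds the real part of every eigenvalue.
\<close>

section \<open>Growth of perturbed linear recurrences\<close>

text \<open>Comparison with K n^\<gamma>: its growth factor (1 + 1/n)^\<gamma> = 1 + \<gamma>/n +
  O(1/n^2) beats 1 + c/n, and the surplus, of order K n^(\<gamma>-1), absorbs the forcing term once
  K is large.\<close>

lemma bigo_powr_of_recurrence:
  fixes a :: "nat \<Rightarrow> real" and c C \<gamma> :: real
  assumes "c < \<gamma>" and nonneg: "\<And>n. 0 \<le> a n"
    and rec: "\<forall>\<^sub>F n in sequentially. a (Suc n) \<le> (1 + c / n) * a n + C * real n powr (\<gamma> - 1)"
  shows "a \<in> O(\<lambda>n. real n powr \<gamma>)"
proof -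
  \<comment> \<open>\<open>g\<close> splits the gap: \<gamma> - g pays for the second-order error of
    (1 + 1/n)^\<gamma>, and g - c pays for the forcing term.\<close>
  define g where "g = (c + \<gamma>) / 2"
  have g: "c < g" "g < \<gamma>" using assms(1) by (auto simp: g_def)
  have "\<forall>\<^sub>F n in sequentially. 1 + g / real n \<le> (1 + 1 / real n) powr \<gamma>"
    using g by real_asymp
  moreover have "\<forall>\<^sub>F n in sequentially. 0 \<le> 1 + c / real n" by real_asymp
  ultimately have "\<forall>\<^sub>F n in sequentially. 1 + g / real n \<le> (1 + 1 / real n) powr \<gamma> \<and>
      0 \<le> 1 + c / real n \<and> 1 \<le> n \<and>
      a (Suc n) \<le> (1 + c / n) * a n + C * real n powr (\<gamma> - 1)"
    using rec eventually_ge_at_top[of 1] by eventually_elim auto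
  then obtain m where m: "\<And>n. n \<ge> m \<Longrightarrow> 1 + g / real n \<le> (1 + 1 / real n) powr \<gamma> \<and>
      0 \<le> 1 + c / real n \<and> 1 \<le> n \<and>
      a (Suc n) \<le> (1 + c / n) * a n + C * real n powr (\<gamma> - 1)"
    unfolding eventually_sequentially by blast
  \<comment> \<open>The first entry starts the induction at \<open>m\<close>; the second gives (g -
    c) K \<ge> |C|.\<close>
  define K where "K = max (a m / real m powr \<gamma>) (\<bar>C\<bar> / (g - c))"
  have K0: "0 \<le> K" using g by (auto simp: K_def le_max_iff_disj)
  have "\<bar>C\<bar> / (g - c) \<le> K" by (simp add: K_def)
  then have KC: "c * K + C \<le> g * K"
    using g by (simp add: field_simps abs_if split: if_splits)
  have bound: "a n \<le> K * real n powr \<gamma>" if "m \<le> n" for n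
    using that
  proof (induction n rule: dec_induct)
    case base
    have "a m / real m powr \<gamma> \<le> K" by (simp add: K_def)
    moreover have "real m powr \<gamma> > 0" using m[of m] by simp
    ultimately show ?case by (simp add: field_simps)
  next
    case (step n)
    have n: "n \<ge> 1" and gn: "1 + g / real n \<le> (1 + 1 / real n) powr \<gamma>"
      and cn: "0 \<le> 1 + c / real n"
      and an: "a (Suc n) \<le> (1 + c / n) * a n + C * real n powr (\<gamma> - 1)"
      using m[of n] step by auto
    have "a (Suc n) \<le> (1 + c / n) * (K * real n powr \<gamma>) + C * real n powr (\<gamma> - 1)"
      using an mult_left_mono[OF step.IH cn] by linarith
    also have "real n powr (\<gamma> - 1) = real n powr \<gamma> / n"
      using n by (simp add: powr_diff)
    also have "(1 + c / n) * (K * real n powr \<gamma>) + C * (real n powr \<gamma> / n)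
        = real n powr \<gamma> * (K + (c * K + C) / n)"
      using n by (simp add: field_simps)
    also have "\<dots> \<le> real n powr \<gamma> * (K + (g * K) / n)"
      using KC by (intro mult_left_mono add_left_mono divide_right_mono) auto
    also have "\<dots> = K * (real n powr \<gamma> * (1 + g / n))"
      by (simp add: algebra_simps)
    also have "\<dots> \<le> K * (real n powr \<gamma> * (1 + 1 / real n) powr \<gamma>)"
      using gn K0 by (intro mult_left_mono) auto
    also have "real n powr \<gamma> * (1 + 1 / real n) powr \<gamma> = real (Suc n) powr \<gamma>"
    proof -
      have "real n * (1 + 1 / real n) = real (Suc n)" using n by (simp add: field_simps)
      then show ?thesis by (metis powr_mult)
    qed
    finally show ?case .
  qed
  show ?thesis
    using bound nonneg by (intro bigoI[of _ K] eventually_sequentiallyI[of m]) auto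
qed

text \<open>|1 + z/n|^2 = 1 + 2 Re z / n + |z|^2 / n^2, so the imaginary part enters only at second
  order. Hence only real parts of eigenvalues govern the growth.\<close>

lemma norm_one_plus_divide_le:
  fixes z :: complex
  assumes "Re z < c"
  shows "\<forall>\<^sub>F n in sequentially. norm (1 + z / of_nat n) \<le> 1 + c / real n"
proof -
  \<comment> \<open>Chosen so that the squares of the two sides differ by (2 d + e/n) / n.\<close>
  define d e where "d = c - Re z" and "e = c\<^sup>2 - (Re z)\<^sup>2 - (Im z)\<^sup>2"
  have "d > 0" using assms by (simp add: d_def)
  then have "\<forall>\<^sub>F n in sequentially. 0 \<le> 2 * d + e / real n" by real_asymp
  moreover have "\<forall>\<^sub>F n in sequentially. 0 \<le> 1 + c / real n" by real_asymp
  ultimately show ?thesis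
    using eventually_gt_at_top[of 0]
  proof eventually_elim
    case (elim n)
    have "(1 + c / n)\<^sup>2 - ((1 + Re z / n)\<^sup>2 + (Im z / n)\<^sup>2) = (2 * d + e / n) / n"
      using elim(3) by (simp add: d_def e_def field_simps power2_eq_square)
    then have "(1 + Re z / n)\<^sup>2 + (Im z / n)\<^sup>2 \<le> (1 + c / n)\<^sup>2"
      using elim(1) by (smt (verit) divide_nonneg_nonneg of_nat_0_le_iff)
    then show ?case
      using elim(2) by (auto simp: cmod_def intro!: real_le_lsqrt)
  qed
qed

text \<open>The hypotheses bound \<nu> itself, not its increments at the order n^(\<gamma>-1).
  Subtracting \<nu> from \<open>t\<close> removes the increments: y = t - \<nu> satisfies y_(n+1) =
  (1 + z/n) y_n + (z \<nu>_n + r_n) / n, whose forcing term has the order that the comparison lemma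
  asks for.\<close>

lemma bigo_powr_of_perturbed_recurrence:
  fixes t r \<nu> :: "nat \<Rightarrow> complex" and z :: complex and \<gamma> :: real
  assumes z: "Re z < \<gamma>"
    and r: "(\<lambda>n. norm (r n)) \<in> O(\<lambda>n. real n powr \<gamma>)"
    and \<nu>: "(\<lambda>n. norm (\<nu> n)) \<in> O(\<lambda>n. real n powr \<gamma>)"
    and rec: "\<And>n. n \<ge> 1 \<Longrightarrow>
      t (Suc n) = t n + (z * t n + r n) / of_nat n + (\<nu> (Suc n) - \<nu> n)"
  shows "(\<lambda>n. norm (t n)) \<in> O(\<lambda>n. real n powr \<gamma>)"
proof -
  define y where "y n = t n - \<nu> n" for n
  define f where "f n = z * \<nu> n + r n" for n
  have "(\<lambda>n. norm z * norm (\<nu> n) + norm (r n)) \<in> O(\<lambda>n. real n powr \<gamma>)"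
    by (intro sum_in_bigo) (use r \<nu> in auto)
  then obtain C where C: "\<forall>\<^sub>F n in sequentially.
      norm (norm z * norm (\<nu> n) + norm (r n)) \<le> C * norm (real n powr \<gamma>)"
    by (elim landau_o.bigE)
  \<comment> \<open>One gap is spent on the norm of 1 + z/n, the other on the comparison
    lemma.\<close>
  obtain c where c: "Re z < c" "c < \<gamma>" using z dense by blast
  have "\<forall>\<^sub>F n in sequentially.
      norm (y (Suc n)) \<le> (1 + c / n) * norm (y n) + C * real n powr (\<gamma> - 1)"
    using C norm_one_plus_divide_le[OF c(1)] eventually_ge_at_top[of 1]
  proof eventually_elim
    case (elim n)
    have "norm (f n) \<le> norm z * norm (\<nu> n) + norm (r n)"
      unfolding f_def by (metis norm_triangle_ineq norm_mult)
    also have "\<dots> \<le> C * real n powr \<gamma>"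
      using elim(1) by simp
    finally have f: "norm (f n) \<le> C * real n powr \<gamma>" .
    have "y (Suc n) = (1 + z / of_nat n) * y n + f n / of_nat n"
      using elim(3) unfolding y_def f_def rec[OF elim(3)] by (simp add: field_simps)
    then have "norm (y (Suc n)) \<le> norm (1 + z / of_nat n) * norm (y n) + norm (f n) / n"
      by (metis norm_triangle_ineq norm_mult norm_divide norm_of_nat)
    also have "\<dots> \<le> (1 + c / n) * norm (y n) + C * real n powr \<gamma> / n"
      using elim(2) f by (intro add_mono mult_right_mono divide_right_mono) auto
    also have "C * real n powr \<gamma> / n = C * real n powr (\<gamma> - 1)"
      using elim(3) by (simp add: powr_diff)
    finally show ?case .
  qed
  then have "(\<lambda>n. norm (y n)) \<in> O(\<lambda>n. real n powr \<gamma>)"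
    by (intro bigo_powr_of_recurrence[OF c(2)]) auto
  then have "(\<lambda>n. norm (y n) + norm (\<nu> n)) \<in> O(\<lambda>n. real n powr \<gamma>)"
    using \<nu> by (intro sum_in_bigo)
  moreover have "(\<lambda>n. norm (t n)) \<in> O(\<lambda>n. norm (y n) + norm (\<nu> n))"
  proof (intro landau_o.big_mono always_eventually allI)
    show "norm (norm (t n)) \<le> norm (norm (y n) + norm (\<nu> n))" for n
      using norm_triangle_ineq[of "y n" "\<nu> n"] by (simp add: y_def)
  qed
  ultimately show ?thesis by (rule landau_o.big_trans[rotated])
qed

section \<open>Matrix recurrences in a triangularising basis\<close>

lemma index_mult_mat_sum:
  assumes "A \<in> carrier_mat n m" "B \<in> carrier_mat m l" "i < n" "j < l"
  shows "(A * B) $$ (i, j) = (\<Sum>r<m. A $$ (i, r) * B $$ (r, j))"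
  using assms by (simp add: scalar_prod_def atLeast0LessThan)

text \<open>The coefficients \<open>c\<close> are constant in \<open>n\<close>, so fixed linear
  changes of coordinates keep the growth order.\<close>

lemma norm_sum_mult_in_bigo:
  fixes f :: "nat \<Rightarrow> 'i \<Rightarrow> complex"
  assumes "\<And>i. i \<in> I \<Longrightarrow> (\<lambda>n. norm (f n i)) \<in> O(g)"
  shows "(\<lambda>n. norm (\<Sum>i\<in>I. f n i * c i)) \<in> O(g :: nat \<Rightarrow> real)"
proof -
  have "(\<lambda>n. \<Sum>i\<in>I. norm (f n i) * norm (c i)) \<in> O(g)"
    using assms by (intro big_sum_in_bigo) (simp add: mult.commute)
  moreover have "(\<lambda>n. norm (\<Sum>i\<in>I. f n i * c i)) \<in> O(\<lambda>n. \<Sum>i\<in>I. norm (f n i) * norm (c i))"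
  proof (intro landau_o.big_mono always_eventually allI)
    fix n
    have "norm (\<Sum>i\<in>I. f n i * c i) \<le> (\<Sum>i\<in>I. norm (f n i) * norm (c i))"
      by (rule sum_norm_le) (simp add: norm_mult)
    then show "norm (norm (\<Sum>i\<in>I. f n i * c i)) \<le> norm (\<Sum>i\<in>I. norm (f n i) * norm (c i))"
      by simp
  qed
  ultimately show ?thesis by (rule landau_o.big_trans[rotated])
qed

text \<open>A Schur decomposition suffices in place of diagonalisation: the entries of
  \<open>U\<close> above the diagonal only feed earlier coordinates, divided by n, into later ones.
  This costs no power of n, since \<gamma> strictly exceeds the real part of every diagonal
  entry.\<close>

lemma bigo_powr_of_matrix_recurrence:
  fixes B :: "real mat" and S N :: "nat \<Rightarrow> nat \<Rightarrow> real" and \<gamma> :: real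
  assumes B: "B \<in> carrier_mat k k"
    and spec: "\<And>z. z \<in> spectrum (map_mat complex_of_real B) \<Longrightarrow> Re z < \<gamma>"
    and N: "\<And>j. j < k \<Longrightarrow> (\<lambda>n. N n j) \<in> O(\<lambda>n. real n powr \<gamma>)"
    and rec: "\<And>n j. n \<ge> 1 \<Longrightarrow> j < k \<Longrightarrow>
      S (Suc n) j = S n j + (\<Sum>i<k. S n i * B $$ (i, j)) / n + (N (Suc n) j - N n j)"
    and j: "j < k"
  shows "(\<lambda>n. S n j) \<in> O(\<lambda>n. real n powr \<gamma>)"
proof -
  define A where "A = map_mat complex_of_real B"
  have A: "A \<in> carrier_mat k k" using B by (simp add: A_def)
  obtain es where es: "char_poly A = (\<Prod>a\<leftarrow>es. [:- a, 1:])"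
    using char_poly_factorized[OF A] by blast
  obtain U P Q where UPQ: "schur_decomposition A es = (U, P, Q)"
    by (cases "schur_decomposition A es") auto
  note schur = schur_decomposition[OF A es UPQ]
  have wit: "similar_mat_wit A U P Q" and tri: "upper_triangular U" and diag: "diag_mat U = es"
    using schur by auto
  note w = similar_mat_witD2[OF A wit]
  have carr: "U \<in> carrier_mat k k" "P \<in> carrier_mat k k" "Q \<in> carrier_mat k k"
    and PQ: "P * Q = 1\<^sub>m k" and QP: "Q * P = 1\<^sub>m k" and APUQ: "A = P * U * Q"
    using w by auto
  have "A * P = P * U * (Q * P)"
    unfolding APUQ using carr by (metis assoc_mult_mat mult_carrier_mat)
  then have AP: "A * P = P * U"
    using QP carr by simp
  have AP_entry: "(\<Sum>i<k. A $$ (l, i) * P $$ (i, m)) = (\<Sum>i<k. P $$ (l, i) * U $$ (i, m))"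
    if "l < k" "m < k" for l m
    using that index_mult_mat_sum[OF A carr(2)] index_mult_mat_sum[OF carr(2,1)] AP by metis
  have diag_less: "Re (U $$ (m, m)) < \<gamma>" if "m < k" for m
  proof -
    have "U $$ (m, m) \<in> set es"
      using that carr(1) by (auto simp: diag[symmetric] diag_mat_def)
    then have "poly (char_poly A) (U $$ (m, m)) = 0"
      unfolding es by (auto simp: poly_prod_list prod_list_zero_iff)
    then have "eigenvalue A (U $$ (m, m))"
      by (simp add: eigenvalue_root_char_poly[OF A])
    then show ?thesis
      using spec by (simp add: spectrum_def A_def)
  qed
  \<comment> \<open>\<open>S\<close> is a row vector, so its new coordinates are S P; by A P = P U
    they follow a recurrence with matrix \<open>U\<close>.\<close>
  define T where "T n m = (\<Sum>i<k. of_real (S n i) * P $$ (i, m))" for n m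
  define \<nu> where "\<nu> n m = (\<Sum>i<k. of_real (N n i) * P $$ (i, m))" for n m
  have \<nu>: "(\<lambda>n. norm (\<nu> n m)) \<in> O(\<lambda>n. real n powr \<gamma>)" for m
    unfolding \<nu>_def using N by (intro norm_sum_mult_in_bigo) simp
  have T_rec: "T (Suc n) m =
      T n m + (U $$ (m, m) * T n m + (\<Sum>i<m. T n i * U $$ (i, m))) / of_nat n
        + (\<nu> (Suc n) m - \<nu> n m)"
    if n: "n \<ge> 1" and m: "m < k" for n m
  proof -
    define G where "G i = (\<Sum>l<k. of_real (S n l) * A $$ (l, i))" for i
    have "T (Suc n) m = (\<Sum>i<k. (of_real (S n i) + G i / of_nat n
        + (of_real (N (Suc n) i) - of_real (N n i))) * P $$ (i, m))"
      unfolding T_def using B by (intro sum.cong refl) (simp add: rec[OF n] A_def G_def)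
    also have "\<dots> = T n m + (\<Sum>i<k. G i * P $$ (i, m)) / of_nat n
        + (\<nu> (Suc n) m - \<nu> n m)"
      unfolding T_def \<nu>_def
      by (simp add: ring_distribs sum.distrib sum_subtractf sum_divide_distrib)
    also have "(\<Sum>i<k. G i * P $$ (i, m))
        = (\<Sum>l<k. of_real (S n l) * (\<Sum>i<k. A $$ (l, i) * P $$ (i, m)))"
      unfolding G_def sum_distrib_right sum_distrib_left
      by (subst sum.swap) (simp add: mult.assoc)
    also have "\<dots> = (\<Sum>l<k. of_real (S n l) * (\<Sum>i<k. P $$ (l, i) * U $$ (i, m)))"
      using AP_entry m by simp
    also have "\<dots> = (\<Sum>i<k. T n i * U $$ (i, m))"
      unfolding T_def sum_distrib_right sum_distrib_left
      by (subst sum.swap) (simp add: mult.assoc)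
    also have "\<dots> = (\<Sum>i<Suc m. T n i * U $$ (i, m))"
      using m carr(1) tri
      by (intro sum.mono_neutral_right) (auto simp: upper_triangular_def)
    also have "\<dots> = U $$ (m, m) * T n m + (\<Sum>i<m. T n i * U $$ (i, m))"
      by simp
    finally show ?thesis .
  qed
  have T: "(\<lambda>n. norm (T n m)) \<in> O(\<lambda>n. real n powr \<gamma>)" if "m < k" for m
    using that
  proof (induction m rule: less_induct)
    case (less m)
    \<comment> \<open>The coordinates before \<open>m\<close> already have the right order and act
      as the perturbation \<open>r\<close>.\<close>
    have "(\<lambda>n. norm (\<Sum>i<m. T n i * U $$ (i, m))) \<in> O(\<lambda>n. real n powr \<gamma>)"
      using less by (intro norm_sum_mult_in_bigo) auto
    then show ?case
      using bigo_powr_of_perturbed_recurrence[OF diag_less _ \<nu> T_rec] less.prems by blast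
  qed
  have "complex_of_real (S n j) = (\<Sum>i<k. T n i * Q $$ (i, j))" for n
  proof -
    have "(\<Sum>i<k. T n i * Q $$ (i, j)) = (\<Sum>l<k. of_real (S n l) * (P * Q) $$ (l, j))"
      unfolding T_def sum_distrib_right
      by (subst sum.swap)
        (simp add: index_mult_mat_sum[OF carr(2,3)] j sum_distrib_left mult.assoc
          del: index_mult_mat)
    also have "\<dots> = (\<Sum>l<k. if l = j then of_real (S n l) else 0)"
      unfolding PQ by (intro sum.cong) (use j in auto)
    finally show ?thesis using j by simp
  qed
  moreover have "(\<lambda>n. norm (\<Sum>i<k. T n i * Q $$ (i, j))) \<in> O(\<lambda>n. real n powr \<gamma>)"
    using T by (intro norm_sum_mult_in_bigo) auto
  ultimately have "(\<lambda>n. norm (complex_of_real (S n j))) \<in> O(\<lambda>n. real n powr \<gamma>)"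
    by simp
  then show ?thesis by simp
qed

section \<open>Exponential moments and independence\<close>

text \<open>With s = \<gamma> - 1/2 this is the summability that Borel-Cantelli asks of the
  martingale tails.\<close>

lemma summable_exp_minus_powr:
  fixes s :: real
  assumes "s > 0"
  shows "summable (\<lambda>n. exp (1/2 - real n powr s))"
proof (rule summable_comparison_test_bigo)
  show "summable (\<lambda>n. norm (real n powr -2))" by (simp add: summable_real_powr_iff)
  show "(\<lambda>n. exp (1/2 - real n powr s)) \<in> O(\<lambda>n. real n powr -2)"
    using assms by real_asymp
qed

text \<open>Finitely many countably valued coordinates generate a discrete product space, on which
  every function is measurable. This covers functions defined by recursion on the noise.\<close>

lemma (in prob_space) measurable_of_finite_subfamily:
  fixes Z :: "'i \<Rightarrow> 'a \<Rightarrow> 'b::countable"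
  assumes "indep_vars (\<lambda>_. count_space UNIV) Z I" "finite A" "A \<subseteq> I" "F \<in> UNIV \<rightarrow> space N"
  shows "(\<lambda>\<omega>. F (restrict (\<lambda>i. Z i \<omega>) A)) \<in> measurable M N"
proof -
  have "(\<lambda>\<omega>. restrict (\<lambda>i. Z i \<omega>) A) \<in> measurable M (PiM A (\<lambda>_. count_space UNIV))"
    using assms by (intro measurable_restrict) (auto simp: indep_vars_def)
  moreover have "PiM A (\<lambda>_. count_space (UNIV :: 'b set)) = count_space (PiE A (\<lambda>_. UNIV))"
    using assms by (intro count_space_PiM_finite) auto
  ultimately have "(\<lambda>\<omega>. restrict (\<lambda>i. Z i \<omega>) A) \<in> measurable M (count_space (PiE A (\<lambda>_. UNIV)))"
    by simp
  moreover have "F \<in> measurable (count_space (PiE A (\<lambda>_. UNIV))) N"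
    using assms(4) by auto
  ultimately show ?thesis by (rule measurable_compose)
qed

text \<open>This takes the place of conditioning: the block \<open>A\<close> (the past) is frozen
  while the block \<open>B\<close> (the fresh noise) is integrated out. Joint measurability of
  \<open>F\<close> is automatic on the discrete product.\<close>

lemma (in prob_space) nn_integral_indep_subfamilies:
  fixes Z :: "'i \<Rightarrow> 'a \<Rightarrow> 'b::countable"
  assumes ind: "indep_vars (\<lambda>_. count_space UNIV) Z I"
    and A: "finite A" "A \<subseteq> I" and B: "finite B" "B \<subseteq> I" and "A \<inter> B = {}"
  shows "(\<integral>\<^sup>+\<omega>. F (restrict (\<lambda>i. Z i \<omega>) A) (restrict (\<lambda>i. Z i \<omega>) B) \<partial>M)
    = (\<integral>\<^sup>+\<omega>. \<integral>\<^sup>+\<omega>'. F (restrict (\<lambda>i. Z i \<omega>) A) (restrict (\<lambda>i. Z i \<omega>') B) \<partial>M \<partial>M)"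
proof -
  define ZA ZB where "ZA = (\<lambda>\<omega>. restrict (\<lambda>i. Z i \<omega>) A)" and "ZB = (\<lambda>\<omega>. restrict (\<lambda>i. Z i \<omega>) B)"
  define SA SB where "SA = (PiE A (\<lambda>_. UNIV) :: ('i \<Rightarrow> 'b) set)"
    and "SB = (PiE B (\<lambda>_. UNIV) :: ('i \<Rightarrow> 'b) set)"
  have "PiM A (\<lambda>_. count_space (UNIV :: 'b set)) = count_space SA"
    "PiM B (\<lambda>_. count_space (UNIV :: 'b set)) = count_space SB"
    unfolding SA_def SB_def using A B by (intro count_space_PiM_finite; simp)+
  with indep_var_restrict[OF ind \<open>A \<inter> B = {}\<close> A(2) B(2)]
  have iv: "indep_var (count_space SA) ZA (count_space SB) ZB"
    by (simp add: ZA_def ZB_def)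
  have [measurable]: "ZA \<in> measurable M (count_space SA)" "ZB \<in> measurable M (count_space SB)"
    using iv by (auto dest: indep_var_rv1 indep_var_rv2)
  have countable: "countable SA" "countable SB"
    unfolding SA_def SB_def using A B by (auto intro: countable_PiE)
  have pair: "count_space SA \<Otimes>\<^sub>M count_space SB = count_space (SA \<times> SB)"
    by (rule pair_measure_countable) fact+
  have F: "(\<lambda>(x, y). F x y) \<in> borel_measurable (count_space SA \<Otimes>\<^sub>M count_space SB)"
    unfolding pair by simp
  interpret PA: prob_space "distr M (count_space SA) ZA" by (rule prob_space_distr) measurable
  interpret PB: prob_space "distr M (count_space SB) ZB" by (rule prob_space_distr) measurable
  interpret P: pair_sigma_finite "distr M (count_space SA) ZA" "distr M (count_space SB) ZB" ..
  have "(\<integral>\<^sup>+\<omega>. F (ZA \<omega>) (ZB \<omega>) \<partial>M)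
      = (\<integral>\<^sup>+x. (\<lambda>(x, y). F x y) x \<partial>distr M (count_space SA \<Otimes>\<^sub>M count_space SB) (\<lambda>\<omega>. (ZA \<omega>, ZB \<omega>)))"
    using F by (subst nn_integral_distr) auto
  also have "\<dots> = (\<integral>\<^sup>+x. (\<lambda>(x, y). F x y) x \<partial>(distr M (count_space SA) ZA \<Otimes>\<^sub>M distr M (count_space SB) ZB))"
    using iv by (simp add: indep_var_distribution_eq)
  also have "\<dots> = (\<integral>\<^sup>+x. \<integral>\<^sup>+y. F x y \<partial>distr M (count_space SB) ZB \<partial>distr M (count_space SA) ZA)"
    by (subst PB.nn_integral_fst[symmetric]) (use F in \<open>auto cong: measurable_cong_sets\<close>)
  also have "\<dots> = (\<integral>\<^sup>+\<omega>. \<integral>\<^sup>+\<omega>'. F (ZA \<omega>) (ZB \<omega>') \<partial>M \<partial>M)"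
    by (simp add: nn_integral_distr)
  finally show ?thesis by (simp add: ZA_def ZB_def)
qed

text \<open>Hoeffding's lemma on an interval of length 2 gives l^2 2^2 / 8 = l^2 / 2. Negative
  \<open>l\<close> reduces to positive \<open>l\<close> by passing to -f.\<close>

lemma (in prob_space) nn_integral_exp_bounded_le:
  assumes [measurable]: "f \<in> borel_measurable M" and bound: "\<And>\<omega>. \<bar>f \<omega>\<bar> \<le> 1"
  shows "(\<integral>\<^sup>+\<omega>. ennreal (exp (l * (f \<omega> - expectation f))) \<partial>M) \<le> ennreal (exp (l\<^sup>2 / 2))"
proof -
  have *: "(\<integral>\<^sup>+\<omega>. ennreal (exp (c * (g \<omega> - expectation g))) \<partial>M) \<le> ennreal (exp (c\<^sup>2 / 2))"
    if "c > 0" and g[measurable]: "g \<in> borel_measurable M" and "\<And>\<omega>. \<bar>g \<omega>\<bar> \<le> 1" for c and g :: "'a \<Rightarrow> real"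
  proof -
    have "g \<omega> \<in> {-1..1}" for \<omega>
      using that(3)[of \<omega>] by (simp add: abs_le_iff)
    then interpret g: interval_bounded_random_variable M g "-1" 1
      by (intro interval_bounded_random_variable.intro
          interval_bounded_random_variable_axioms.intro prob_space_axioms g always_eventually allI)
    show ?thesis using g.Hoeffdings_lemma_nn_integral[OF \<open>c > 0\<close>] by simp
  qed
  consider "l > 0" | "l < 0" | "l = 0" by linarith
  then show ?thesis
  proof cases
    case 1
    then show ?thesis using *[of l f] bound by simp
  next
    case 2
    then show ?thesis using *[of "-l" "\<lambda>\<omega>. - f \<omega>"] bound by (simp add: algebra_simps)
  next
    case 3
    then show ?thesis by (simp add: emeasure_space_1)
  qed
qed

section \<open>The martingale part of the walk\<close>

context erwg
begin

definition noise :: "rv_index \<Rightarrow> 'a \<Rightarrow> int" where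
  "noise ix = (case ix of
             Sigma_ix v \<Rightarrow> \<sigma> v
           | Xi_ix n v \<Rightarrow> \<xi> n v
           | D_ix n v \<Rightarrow> (\<lambda>\<omega>. int (D n v \<omega>))
           | U_ix n v \<Rightarrow> (\<lambda>\<omega>. int (u n v \<omega>)))"

definition noise_ix :: "rv_index set" where
  "noise_ix = (\<Union>v\<in>{1..k}. \<Union>n\<in>{1..}. {Sigma_ix v, Xi_ix n v, D_ix n v, U_ix n v})"

lemma indep_noise: "indep_vars (\<lambda>_. count_space UNIV) noise noise_ix"
  using indep unfolding noise_def[abs_def] noise_ix_def .

text \<open>
  \<^const>\<open>noise\<close> drives an everywhere defined copy of \<open>X\<close>: \<open>traj n z m v\<close> is \<open>X\<^sub>m\<^sup>(\<^sup>v\<^sup>)\<close> for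
  \<open>1 \<le> m \<le> n\<close> (other \<open>m\<close> give irrelevant values). Taking \<^const>\<open>sgn\<close>, which changes nothing
  almost surely, makes it bounded by 1 for every \<open>z\<close>.
\<close>

primrec traj :: "nat \<Rightarrow> (rv_index \<Rightarrow> int) \<Rightarrow> nat \<Rightarrow> nat \<Rightarrow> int" where
  "traj 0 z = (\<lambda>m v. if v \<in> {1..k} then sgn (z (Sigma_ix v)) else 0)"
| "traj (Suc n) z = (\<lambda>m v. if n = 0 \<or> m \<le> n \<or> v \<notin> {1..k} then traj n z m v
     else sgn (z (Xi_ix n v)) * traj n z (nat (z (D_ix n v))) (nat (z (U_ix n v))))"

text \<open>Times stop below \<open>n\<close> because X_(m+1) is built from the noise of time m.
  Thus \<open>past n\<close> determines X_1, ..., X_n, and the noise of time \<open>n\<close> is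
  fresh.\<close>

definition past :: "nat \<Rightarrow> rv_index set" where
  "past n = (\<Union>v\<in>{1..k}. insert (Sigma_ix v) (\<Union>m\<in>{1..<n}. {Xi_ix m v, D_ix m v, U_ix m v}))"

text \<open>For a frozen history \<open>h\<close> this is the conditional mean of X_(n+1) at vertex
  \<open>v\<close>, that is, entry \<open>v\<close> of the row vector S_n B / n.\<close>

definition drift :: "nat \<Rightarrow> nat \<Rightarrow> (nat \<Rightarrow> nat \<Rightarrow> int) \<Rightarrow> real" where
  "drift n v h = (2 * p v - 1) / card (in_nbrs E v) *
     (\<Sum>i\<in>in_nbrs E v. \<Sum>d=1..n. real_of_int (h d i)) / n"

text \<open>The martingale part of the Doob decomposition, written as a deterministic function of
  the noise. The sum starts at m = 1, so the value at n = 1 is 0 and X_1 only enters the initial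
  value of the walk.\<close>

definition mart :: "nat \<Rightarrow> nat \<Rightarrow> (rv_index \<Rightarrow> int) \<Rightarrow> real" where
  "mart n v z = (\<Sum>m=1..<n. real_of_int (traj (Suc m) z (Suc m) v) - drift m v (traj m z))"

section \<open>Adaptedness, boundedness and measurability\<close>

lemma past: "finite (past n)" "past n \<subseteq> noise_ix"
  by (auto simp: past_def noise_ix_def)

text \<open>Adaptedness in pointwise form: each stage reads only noise of earlier times. It allows
  the noise to be restricted to \<open>past n\<close> before independence is used.\<close>

lemma traj_cong: "(\<And>ix. ix \<in> past n \<Longrightarrow> z ix = z' ix) \<Longrightarrow> traj n z = traj n z'"
proof (induction n)
  case 0
  then show ?case by (auto simp: past_def fun_eq_iff)
next
  case (Suc n)
  have "traj n z = traj n z'" by (rule Suc.IH) (use Suc.prems in \<open>auto simp: past_def\<close>)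
  moreover have "z (Xi_ix n v) = z' (Xi_ix n v)" "z (D_ix n v) = z' (D_ix n v)" "z (U_ix n v) = z' (U_ix n v)"
    if "v \<in> {1..k}" "n \<noteq> 0" for v
    using that by (intro Suc.prems; force simp: past_def)+
  ultimately show ?case by (auto simp: fun_eq_iff)
qed

lemma past_mono: "m \<le> n \<Longrightarrow> past m \<subseteq> past n"
  by (fastforce simp: past_def)

lemma mart_cong:
  assumes "\<And>ix. ix \<in> past n \<Longrightarrow> z ix = z' ix"
  shows "mart n v z = mart n v z'"
  unfolding mart_def
proof (intro sum.cong refl)
  fix m assume "m \<in> {1..<n}"
  then have "past m \<subseteq> past n" "past (Suc m) \<subseteq> past n" by (auto intro!: past_mono)
  then have "traj (Suc m) z = traj (Suc m) z'" "traj m z = traj m z'"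
    using assms by (blast intro: traj_cong)+
  then show "real_of_int (traj (Suc m) z (Suc m) v) - drift m v (traj m z)
      = real_of_int (traj (Suc m) z' (Suc m) v) - drift m v (traj m z')" by simp
qed

text \<open>The bound is wanted for every \<open>z\<close>, because Hoeffding's lemma is applied
  with the past frozen at an arbitrary value.\<close>

lemma abs_traj_le: "\<bar>traj n z m v\<bar> \<le> 1"
proof (induction n arbitrary: m v)
  case 0
  then show ?case by (simp add: abs_sgn_eq)
next
  case (Suc n)
  then show ?case by (auto simp: abs_mult abs_sgn_eq)
qed

text \<open>Stage \<open>Suc n\<close> rewrites only times above \<open>n\<close>, so recorded
  values persist.\<close>

lemma traj_stable: "m \<le> n \<Longrightarrow> traj n z m = traj m z m"
  by (induction n) (auto simp: fun_eq_iff le_Suc_eq)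

lemma mart_measurable: "(\<lambda>\<omega>. mart n v (\<lambda>ix. noise ix \<omega>)) \<in> borel_measurable M"
proof -
  have "mart n v (\<lambda>ix. noise ix \<omega>) = mart n v (restrict (\<lambda>ix. noise ix \<omega>) (past n))" for \<omega>
    by (rule mart_cong) simp
  then show ?thesis
    using measurable_of_finite_subfamily[OF indep_noise past(1,2)[of n], of "mart n v" borel] by simp
qed

lemma noise_measurable: "ix \<in> noise_ix \<Longrightarrow> noise ix \<in> measurable M (count_space UNIV)"
  using indep_noise by (auto simp: indep_vars_def)

lemma step_measurable:
  assumes "n \<ge> 1" "v \<in> {1..k}"
  shows "\<xi> n v \<in> measurable M (count_space UNIV)" "D n v \<in> measurable M (count_space UNIV)"
    "u n v \<in> measurable M (count_space UNIV)"
proof -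
  have ix: "Xi_ix n v \<in> noise_ix" "D_ix n v \<in> noise_ix" "U_ix n v \<in> noise_ix"
    using assms by (auto simp: noise_ix_def)
  show "\<xi> n v \<in> measurable M (count_space UNIV)"
    using noise_measurable[OF ix(1)] by (simp add: noise_def)
  show "D n v \<in> measurable M (count_space UNIV)"
    using measurable_compose[OF noise_measurable[OF ix(2)], of nat "count_space UNIV"]
    by (simp add: noise_def)
  show "u n v \<in> measurable M (count_space UNIV)"
    using measurable_compose[OF noise_measurable[OF ix(3)], of nat "count_space UNIV"]
    by (simp add: noise_def)
qed

lemma in_nbrs_subset: "in_nbrs E v \<subseteq> {1..k}"
  using edges by (auto simp: in_nbrs_def)

lemma finite_in_nbrs: "finite (in_nbrs E v)"
  using in_nbrs_subset finite_subset by blast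

section \<open>Laws of a single step and its conditional mean\<close>

lemma AE_of_law:
  assumes "distr M (count_space UNIV) Y = measure_pmf d" "Y \<in> measurable M (count_space UNIV)"
  shows "AE \<omega> in M. Y \<omega> \<in> set_pmf d"
proof -
  have "AE y in distr M (count_space UNIV) Y. y \<in> set_pmf d"
    unfolding assms(1) by (simp add: AE_measure_pmf)
  then show ?thesis using assms(2) by (subst (asm) AE_distr_iff) auto
qed

lemma expectation_of_law:
  fixes f :: "'b \<Rightarrow> real"
  assumes "distr M (count_space UNIV) Y = measure_pmf d" "Y \<in> measurable M (count_space UNIV)"
  shows "expectation (\<lambda>\<omega>. f (Y \<omega>)) = measure_pmf.expectation d f"
  unfolding assms(1)[symmetric] by (rule integral_distr[OF assms(2), symmetric]) simp

lemma AE_step: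
  assumes "n \<ge> 1" "v \<in> {1..k}"
  shows "AE \<omega> in M. D n v \<omega> \<in> {1..n}" "AE \<omega> in M. u n v \<omega> \<in> in_nbrs E v"
    "AE \<omega> in M. \<xi> n v \<omega> \<in> {-1, 1}"
proof -
  note m = step_measurable[OF assms]
  have "in_nbrs E v \<noteq> {}" using in_degree[OF assms(2)] by auto
  then show "AE \<omega> in M. u n v \<omega> \<in> in_nbrs E v"
    using AE_of_law[OF law_u[OF assms] m(3)] finite_in_nbrs by simp
  show "AE \<omega> in M. D n v \<omega> \<in> {1..n}"
    using AE_of_law[OF law_D[OF assms] m(2)] assms by (subst (asm) set_pmf_of_set) auto
  show "AE \<omega> in M. \<xi> n v \<omega> \<in> {-1, 1}"
    using AE_of_law[OF law_xi[OF assms] m(1)]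
    by eventually_elim (auto simp: rademacher_pmf_def split: if_splits)
qed

lemma AE_sigma:
  assumes "v \<in> {1..k}"
  shows "AE \<omega> in M. \<sigma> v \<omega> \<in> {-1, 1}"
proof -
  have "Sigma_ix v \<in> noise_ix" using assms by (auto simp: noise_ix_def)
  then have "\<sigma> v \<in> measurable M (count_space UNIV)"
    using noise_measurable[of "Sigma_ix v"] by (simp add: noise_def)
  from AE_of_law[OF law_sigma[OF assms] this] show ?thesis
    by eventually_elim (auto simp: rademacher_pmf_def split: if_splits)
qed

text \<open>The three variables of one step are independent, so the expectation factorises into 2 p
  - 1, the chance 1/n of the time and the chance 1/card of the vertex.\<close>

lemma expectation_single_memory:
  assumes n: "n \<ge> 1" and v: "v \<in> {1..k}" and d: "d \<in> {1..n}" and i: "i \<in> in_nbrs E v"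
  shows "expectation (\<lambda>\<omega>. of_int (sgn (\<xi> n v \<omega>)) * of_bool (D n v \<omega> = d) * of_bool (u n v \<omega> = i))
    = (2 * p v - 1) / card (in_nbrs E v) / n"
    and "integrable M (\<lambda>\<omega>. of_int (sgn (\<xi> n v \<omega>)) * of_bool (D n v \<omega> = d) * of_bool (u n v \<omega> = i) :: real)"
proof -
  define J where "J = {Xi_ix n v, D_ix n v, U_ix n v}"
  \<comment> \<open>One bounded function per kind of index; \<open>int d\<close> and
    \<open>int i\<close> match the embedding of \<open>D\<close> and \<open>u\<close> into the
    integers. The last case also catches \<open>Sigma_ix\<close>, which does not occur in
    \<open>J\<close>.\<close>
  define g :: "rv_index \<Rightarrow> int \<Rightarrow> real" where
    "g ix y = (case ix of Xi_ix _ _ \<Rightarrow> of_int (sgn y) | D_ix _ _ \<Rightarrow> of_bool (y = int d) | _ \<Rightarrow> of_bool (y = int i))"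
    for ix y
  have J: "J \<subseteq> noise_ix" using n v by (auto simp: J_def noise_ix_def)
  have "indep_vars (\<lambda>_. borel) (\<lambda>ix \<omega>. g ix (noise ix \<omega>)) J"
    by (rule indep_vars_compose2[OF indep_vars_subset[OF indep_noise J]]) simp
  moreover have "integrable M (\<lambda>\<omega>. g ix (noise ix \<omega>))" if "ix \<in> J" for ix
  proof (rule integrable_const_bound[where B = 1])
    show "AE \<omega> in M. norm (g ix (noise ix \<omega>)) \<le> 1"
      by (intro always_eventually allI) (auto simp: g_def sgn_if split: rv_index.split)
    show "(\<lambda>\<omega>. g ix (noise ix \<omega>)) \<in> borel_measurable M"
      by (rule measurable_compose[OF noise_measurable]) (use J that in auto)
  qed
  moreover have "finite J" by (simp add: J_def)
  ultimately have eq: "expectation (\<lambda>\<omega>. \<Prod>ix\<in>J. g ix (noise ix \<omega>)) = (\<Prod>ix\<in>J. expectation (\<lambda>\<omega>. g ix (noise ix \<omega>)))"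
    and int: "integrable M (\<lambda>\<omega>. \<Prod>ix\<in>J. g ix (noise ix \<omega>))"
    by (auto intro: indep_vars_lebesgue_integral indep_vars_integrable)
  have prod: "(\<Prod>ix\<in>J. g ix (noise ix \<omega>))
      = of_int (sgn (\<xi> n v \<omega>)) * of_bool (D n v \<omega> = d) * of_bool (u n v \<omega> = i)" for \<omega>
    by (simp add: J_def g_def noise_def)
  from int show "integrable M (\<lambda>\<omega>. of_int (sgn (\<xi> n v \<omega>)) * of_bool (D n v \<omega> = d) * of_bool (u n v \<omega> = i) :: real)"
    unfolding prod .
  note m = step_measurable[OF n v]
  have 1: "expectation (\<lambda>\<omega>. of_int (sgn (\<xi> n v \<omega>))) = 2 * p v - 1"
    using p_range[OF v]
    by (subst expectation_of_law[OF law_xi[OF n v] m(1)]) (simp add: rademacher_pmf_def)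
  have 2: "expectation (\<lambda>\<omega>. of_bool (D n v \<omega> = d)) = 1 / n"
    using d by (subst expectation_of_law[OF law_D[OF n v] m(2)], subst integral_pmf_of_set)
      (auto simp: of_bool_def)
  have 3: "expectation (\<lambda>\<omega>. of_bool (u n v \<omega> = i)) = 1 / card (in_nbrs E v)"
    using i finite_in_nbrs
    by (subst expectation_of_law[OF law_u[OF n v] m(3)], subst integral_pmf_of_set)
      (auto simp: of_bool_def)
  show "expectation (\<lambda>\<omega>. of_int (sgn (\<xi> n v \<omega>)) * of_bool (D n v \<omega> = d) * of_bool (u n v \<omega> = i))
    = (2 * p v - 1) / card (in_nbrs E v) / n"
    using eq unfolding prod by (simp add: J_def g_def noise_def 1 2 3)
qed

text \<open>Almost surely \<open>D\<close> and \<open>u\<close> lie in their finite ranges, so h(D,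
  u) is the sum of h(d, i) over the indicators of D = d and u = i; then linearity applies. Since
  \<open>h\<close> is deterministic, this gives the conditional mean once the past is
  frozen.\<close>

lemma expectation_step:
  assumes n: "n \<ge> 1" and v: "v \<in> {1..k}"
  shows "expectation (\<lambda>\<omega>. of_int (sgn (\<xi> n v \<omega>) * h (D n v \<omega>) (u n v \<omega>))) = drift n v h"
proof -
  define f where "f d i \<omega> = (of_int (sgn (\<xi> n v \<omega>)) * of_bool (D n v \<omega> = d) * of_bool (u n v \<omega> = i) :: real)"
    for d i \<omega>
  note f = expectation_single_memory[OF n v, folded f_def]
  note m[measurable] = step_measurable[OF n v]
  have "expectation (\<lambda>\<omega>. of_int (sgn (\<xi> n v \<omega>) * h (D n v \<omega>) (u n v \<omega>)))
      = expectation (\<lambda>\<omega>. \<Sum>i\<in>in_nbrs E v. \<Sum>d=1..n. of_int (h d i) * f d i \<omega>)"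
  proof (rule integral_cong_AE)
    show "AE \<omega> in M. of_int (sgn (\<xi> n v \<omega>) * h (D n v \<omega>) (u n v \<omega>))
      = (\<Sum>i\<in>in_nbrs E v. \<Sum>d=1..n. of_int (h d i) * f d i \<omega>)"
      using AE_step(1,2)[OF n v]
    proof eventually_elim
      case (elim \<omega>)
      have "(\<Sum>i\<in>in_nbrs E v. \<Sum>d=1..n. of_int (h d i) * f d i \<omega>)
        = (\<Sum>i\<in>in_nbrs E v. \<Sum>d=1..n. if d = D n v \<omega> then
            if i = u n v \<omega> then of_int (sgn (\<xi> n v \<omega>) * h d i) else 0 else 0)"
        unfolding f_def by (intro sum.cong refl) simp
      also have "\<dots> = (\<Sum>i\<in>in_nbrs E v.
            if i = u n v \<omega> then of_int (sgn (\<xi> n v \<omega>) * h (D n v \<omega>) i) else 0)"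
        using elim(1) by (intro sum.cong refl) (subst sum.delta, auto)
      also have "\<dots> = of_int (sgn (\<xi> n v \<omega>) * h (D n v \<omega>) (u n v \<omega>))"
        using elim(2) finite_in_nbrs by (subst sum.delta) auto
      finally show ?case by simp
    qed
    have "(\<lambda>\<omega>. (\<xi> n v \<omega>, D n v \<omega>, u n v \<omega>)) \<in> measurable M (count_space UNIV)"
      by measurable
    from measurable_compose[OF this, of "\<lambda>(x, d, i). of_int (sgn x * h d i)" borel]
    show "(\<lambda>\<omega>. of_int (sgn (\<xi> n v \<omega>) * h (D n v \<omega>) (u n v \<omega>)) :: real) \<in> borel_measurable M"
      by simp
    show "(\<lambda>\<omega>. \<Sum>i\<in>in_nbrs E v. \<Sum>d=1..n. of_int (h d i) * f d i \<omega>) \<in> borel_measurable M"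
      unfolding f_def by measurable
  qed
  also have "\<dots> = (\<Sum>i\<in>in_nbrs E v. expectation (\<lambda>\<omega>. \<Sum>d=1..n. of_int (h d i) * f d i \<omega>))"
    by (intro Bochner_Integration.integral_sum Bochner_Integration.integrable_sum
        integrable_mult_right f(2))
  also have "\<dots> = (\<Sum>i\<in>in_nbrs E v. \<Sum>d=1..n. expectation (\<lambda>\<omega>. of_int (h d i) * f d i \<omega>))"
    by (intro sum.cong refl Bochner_Integration.integral_sum integrable_mult_right f(2))
  also have "\<dots> = (\<Sum>i\<in>in_nbrs E v. \<Sum>d=1..n. of_int (h d i) * expectation (f d i))"
    by simp
  also have "\<dots> = (\<Sum>i\<in>in_nbrs E v. \<Sum>d=1..n. of_int (h d i) * ((2 * p v - 1) / card (in_nbrs E v) / n))"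
    using f(1) by simp
  also have "\<dots> = drift n v h"
    by (simp add: drift_def sum_distrib_left sum_distrib_right sum_divide_distrib mult_ac)
  finally show ?thesis .
qed

section \<open>Exponential moments and almost sure growth of the martingale\<close>

lemma nn_integral_exp_mart_Suc:
  assumes n: "n \<ge> 1" and v: "v \<in> {1..k}"
  shows "(\<integral>\<^sup>+\<omega>. ennreal (exp (l * mart (Suc n) v (\<lambda>ix. noise ix \<omega>))) \<partial>M)
    \<le> (\<integral>\<^sup>+\<omega>. ennreal (exp (l * mart n v (\<lambda>ix. noise ix \<omega>))) \<partial>M) * ennreal (exp (l\<^sup>2 / 2))"
proof -
  define J where "J = {Xi_ix n v, D_ix n v, U_ix n v}"
  have J: "finite J" "J \<subseteq> noise_ix" "past n \<inter> J = {}"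
    using n v by (auto simp: J_def noise_ix_def past_def)
  define inc where "inc h y = (of_int (sgn (y (Xi_ix n v)) * h (nat (y (D_ix n v))) (nat (y (U_ix n v)))) - drift n v h :: real)"
    for h y
  define F where "F w y = ennreal (exp (l * mart n v w) * exp (l * inc (traj n w) y))" for w y
  have split: "ennreal (exp (l * mart (Suc n) v (\<lambda>ix. noise ix \<omega>)))
      = F (restrict (\<lambda>ix. noise ix \<omega>) (past n)) (restrict (\<lambda>ix. noise ix \<omega>) J)" for \<omega>
  proof -
    have "mart n v (\<lambda>ix. noise ix \<omega>) = mart n v (restrict (\<lambda>ix. noise ix \<omega>) (past n))"
      by (rule mart_cong) simp
    moreover have "traj n (\<lambda>ix. noise ix \<omega>) = traj n (restrict (\<lambda>ix. noise ix \<omega>) (past n))"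
      by (rule traj_cong) simp
    \<comment> \<open>The new summand is m = n. Since n \<ge> 1, \<open>traj (Suc n)\<close> at time
      \<open>Suc n\<close> unfolds to the noise of time \<open>n\<close> acting on
      \<open>traj n\<close>.\<close>
    moreover have "mart (Suc n) v (\<lambda>ix. noise ix \<omega>) = mart n v (\<lambda>ix. noise ix \<omega>)
        + inc (traj n (\<lambda>ix. noise ix \<omega>)) (restrict (\<lambda>ix. noise ix \<omega>) J)"
      using n v by (simp add: mart_def inc_def J_def)
    ultimately show ?thesis by (simp add: F_def ring_distribs exp_add)
  qed
  have inner: "(\<integral>\<^sup>+\<omega>'. F w (restrict (\<lambda>ix. noise ix \<omega>') J) \<partial>M)
      \<le> ennreal (exp (l * mart n v w)) * ennreal (exp (l\<^sup>2 / 2))" for w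
  proof -
    define f where "f \<omega> = (of_int (sgn (\<xi> n v \<omega>) * traj n w (D n v \<omega>) (u n v \<omega>)) :: real)" for \<omega>
    note m[measurable] = step_measurable[OF n v]
    have "(\<lambda>\<omega>. (\<xi> n v \<omega>, D n v \<omega>, u n v \<omega>)) \<in> measurable M (count_space UNIV)"
      by measurable
    from measurable_compose[OF this, of "\<lambda>(x, d, i). of_int (sgn x * traj n w d i)" borel]
    have f[measurable]: "f \<in> borel_measurable M" by (simp add: f_def[abs_def])
    have "\<bar>f \<omega>\<bar> \<le> 1" for \<omega>
      using abs_traj_le[of n w "D n v \<omega>" "u n v \<omega>"]
      by (auto simp: f_def abs_mult abs_sgn_eq simp flip: of_int_abs)
    from nn_integral_exp_bounded_le[OF f this, of l]
    have *: "(\<integral>\<^sup>+\<omega>. ennreal (exp (l * (f \<omega> - drift n v (traj n w)))) \<partial>M) \<le> ennreal (exp (l\<^sup>2 / 2))"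
      unfolding expectation_step[OF n v, of "traj n w", folded f_def] .
    have "(\<integral>\<^sup>+\<omega>'. F w (restrict (\<lambda>ix. noise ix \<omega>') J) \<partial>M)
      = (\<integral>\<^sup>+\<omega>'. ennreal (exp (l * mart n v w)) * ennreal (exp (l * (f \<omega>' - drift n v (traj n w)))) \<partial>M)"
      by (simp add: F_def inc_def J_def noise_def f_def ennreal_mult)
    also have "\<dots> = ennreal (exp (l * mart n v w)) * (\<integral>\<^sup>+\<omega>'. ennreal (exp (l * (f \<omega>' - drift n v (traj n w)))) \<partial>M)"
      by (rule nn_integral_cmult) measurable
    also have "\<dots> \<le> ennreal (exp (l * mart n v w)) * ennreal (exp (l\<^sup>2 / 2))"
      by (intro mult_left_mono *) simp
    finally show ?thesis .
  qed
  have "(\<integral>\<^sup>+\<omega>. ennreal (exp (l * mart (Suc n) v (\<lambda>ix. noise ix \<omega>))) \<partial>M)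
      = (\<integral>\<^sup>+\<omega>. \<integral>\<^sup>+\<omega>'. F (restrict (\<lambda>ix. noise ix \<omega>) (past n)) (restrict (\<lambda>ix. noise ix \<omega>') J) \<partial>M \<partial>M)"
    unfolding split by (rule nn_integral_indep_subfamilies[OF indep_noise]) (use past J in auto)
  also have "\<dots> \<le> (\<integral>\<^sup>+\<omega>. ennreal (exp (l * mart n v (restrict (\<lambda>ix. noise ix \<omega>) (past n)))) * ennreal (exp (l\<^sup>2 / 2)) \<partial>M)"
    by (intro nn_integral_mono inner)
  also have "\<dots> = (\<integral>\<^sup>+\<omega>. ennreal (exp (l * mart n v (\<lambda>ix. noise ix \<omega>))) * ennreal (exp (l\<^sup>2 / 2)) \<partial>M)"
    using mart_cong[of n "restrict (\<lambda>ix. noise ix _) (past n)" "\<lambda>ix. noise ix _"] by simp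
  also have "\<dots> = (\<integral>\<^sup>+\<omega>. ennreal (exp (l * mart n v (\<lambda>ix. noise ix \<omega>))) \<partial>M) * ennreal (exp (l\<^sup>2 / 2))"
    using mart_measurable by (intro nn_integral_multc) simp
  finally show ?thesis .
qed

text \<open>Only n - 1 increments have accumulated, so the exponent has one summand to
  spare.\<close>

lemma nn_integral_exp_mart_le:
  assumes n: "n \<ge> 1" and v: "v \<in> {1..k}"
  shows "(\<integral>\<^sup>+\<omega>. ennreal (exp (l * mart n v (\<lambda>ix. noise ix \<omega>))) \<partial>M) \<le> ennreal (exp (n * l\<^sup>2 / 2))"
  using n
proof (induction n rule: dec_induct)
  case base
  then show ?case by (simp add: mart_def emeasure_space_1)
next
  case (step n)
  note nn_integral_exp_mart_Suc[OF step.hyps(1) v, of l]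
  also have "(\<integral>\<^sup>+\<omega>. ennreal (exp (l * mart n v (\<lambda>ix. noise ix \<omega>))) \<partial>M) * ennreal (exp (l\<^sup>2 / 2))
      \<le> ennreal (exp (n * l\<^sup>2 / 2)) * ennreal (exp (l\<^sup>2 / 2))"
    by (intro mult_right_mono step.IH) simp
  also have "\<dots> = ennreal (exp (Suc n * l\<^sup>2 / 2))"
    by (simp add: ennreal_mult[symmetric] exp_add[symmetric] field_simps)
  finally show ?case .
qed

text \<open>Chernoff's bound; the sign \<open>c\<close> covers both tails at once.\<close>

lemma prob_mart_ge:
  assumes n: "n \<ge> 1" and v: "v \<in> {1..k}" and c: "\<bar>c\<bar> = 1"
  shows "prob {\<omega> \<in> space M. a \<le> c * mart n v (\<lambda>ix. noise ix \<omega>)} \<le> exp (1/2 - a / sqrt n)"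
proof -
  note [measurable] = mart_measurable
  \<comment> \<open>This scale keeps the moment bound at the constant exp(1/2). The resulting tail
    is weaker than Gaussian but summable at the levels a = n^\<gamma> with \<gamma> > 1/2.\<close>
  define s where "s = 1 / sqrt n"
  have s: "s > 0" using n by (simp add: s_def)
  have "emeasure M {\<omega> \<in> space M. a \<le> c * mart n v (\<lambda>ix. noise ix \<omega>)}
      \<le> ennreal (exp (- s * a)) *
        (\<integral>\<^sup>+\<omega>. ennreal (exp (s * (c * mart n v (\<lambda>ix. noise ix \<omega>)))) * indicator (space M) \<omega> \<partial>M)"
    by (rule Chernoff_ineq_nn_integral_ge[OF s]) measurable
  also have "(\<integral>\<^sup>+\<omega>. ennreal (exp (s * (c * mart n v (\<lambda>ix. noise ix \<omega>)))) * indicator (space M) \<omega> \<partial>M)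
      = (\<integral>\<^sup>+\<omega>. ennreal (exp ((s * c) * mart n v (\<lambda>ix. noise ix \<omega>))) \<partial>M)"
    by (intro nn_integral_cong) (simp add: mult.assoc)
  also have "\<dots> \<le> ennreal (exp (n * (s * c)\<^sup>2 / 2))"
    by (rule nn_integral_exp_mart_le[OF n v])
  also have "n * (s * c)\<^sup>2 / 2 = 1 / 2"
    using n c by (simp add: s_def power_mult_distrib power_divide abs_square_eq_1)
  finally have "emeasure M {\<omega> \<in> space M. a \<le> c * mart n v (\<lambda>ix. noise ix \<omega>)}
      \<le> ennreal (exp (- s * a)) * ennreal (exp (1 / 2))"
    by (simp add: mult_left_mono)
  also have "\<dots> = ennreal (exp (1/2 - a / sqrt n))"
    by (simp add: ennreal_mult[symmetric] exp_add[symmetric] s_def)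
  finally show ?thesis by (simp add: emeasure_eq_measure)
qed

text \<open>At level n^\<gamma> the tail is at most exp(1/2 - n^(\<gamma>-1/2)), which is summable,
  and Borel-Cantelli applies.\<close>

lemma AE_eventually_mart_less:
  assumes v: "v \<in> {1..k}" and \<gamma>: "\<gamma> > 1/2" and c: "\<bar>c\<bar> = 1"
  shows "AE \<omega> in M. \<forall>\<^sub>F n in sequentially. c * mart n v (\<lambda>ix. noise ix \<omega>) < real n powr \<gamma>"
proof -
  note [measurable] = mart_measurable
  define A where "A n = {\<omega> \<in> space M. real n powr \<gamma> \<le> c * mart n v (\<lambda>ix. noise ix \<omega>)}" for n
  have "AE \<omega> in M. \<forall>\<^sub>F n in sequentially. \<omega> \<in> space M - A n"
  proof (rule borel_cantelli_AE1)
    show "A n \<in> sets M" for n unfolding A_def by measurable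
    show "emeasure M (A n) < \<infinity>" for n by (simp add: less_top[symmetric])
    have "\<forall>\<^sub>F n in sequentially. norm (measure M (A n)) \<le> exp (1/2 - real n powr (\<gamma> - 1/2))"
      using eventually_ge_at_top[of 1]
    proof eventually_elim
      case (elim n)
      have "real n powr \<gamma> / sqrt n = real n powr (\<gamma> - 1/2)"
        using elim by (simp add: powr_diff powr_half_sqrt)
      then show ?case using prob_mart_ge[OF elim v c, of "real n powr \<gamma>"] by (simp add: A_def)
    qed
    then show "summable (\<lambda>n. measure M (A n))"
      by (rule summable_comparison_test_ev) (use \<gamma> in \<open>simp add: summable_exp_minus_powr\<close>)
  qed
  then show ?thesis
    by eventually_elim (auto simp: A_def elim!: eventually_mono)
qed

lemma AE_mart_bigo:
  assumes v: "v \<in> {1..k}" and \<gamma>: "\<gamma> > 1/2"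
  shows "AE \<omega> in M. (\<lambda>n. mart n v (\<lambda>ix. noise ix \<omega>)) \<in> O(\<lambda>n. real n powr \<gamma>)"
  using AE_eventually_mart_less[OF v \<gamma>, of 1, simplified]
    AE_eventually_mart_less[OF v \<gamma>, of "-1", simplified]
proof eventually_elim
  case (elim \<omega>)
  from elim have "\<forall>\<^sub>F n in sequentially. norm (mart n v (\<lambda>ix. noise ix \<omega>)) \<le> 1 * norm (real n powr \<gamma>)"
    by eventually_elim auto
  then show ?case by (rule bigoI)
qed

section \<open>The walk as a perturbed linear recurrence\<close>

text \<open>Countably many null sets are discarded together. Off them \<open>sgn\<close> fixes the
  signs, and D_m \<le> m points to an earlier time, so strong induction on time works for all
  vertices simultaneously.\<close>

lemma AE_X_eq_traj:
  "AE \<omega> in M. \<forall>n\<ge>1. \<forall>v\<in>{1..k}. X n v \<omega> = traj n (\<lambda>ix. noise ix \<omega>) n v"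
proof -
  have "AE \<omega> in M. \<forall>v\<in>{1..k}. \<sigma> v \<omega> \<in> {-1, 1} \<and> X 1 v \<omega> = \<sigma> v \<omega>"
    by (intro AE_ball_countable' AE_conjI AE_sigma X_1) auto
  moreover have "AE \<omega> in M. \<forall>v\<in>{1..k}. \<forall>n\<in>{1..}. D n v \<omega> \<in> {1..n} \<and> u n v \<omega> \<in> in_nbrs E v
      \<and> \<xi> n v \<omega> \<in> {-1, 1} \<and> X (Suc n) v \<omega> = \<xi> n v \<omega> * X (D n v \<omega>) (u n v \<omega>) \<omega>"
    by (intro AE_ball_countable' AE_conjI AE_step X_Suc) auto
  ultimately show ?thesis
  proof eventually_elim
    case (elim \<omega>)
    have "X n v \<omega> = traj n (\<lambda>ix. noise ix \<omega>) n v" if "n \<ge> 1" "v \<in> {1..k}" for n v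
      using that
    proof (induction n arbitrary: v rule: less_induct)
      case (less n)
      show ?case
      proof (cases "n = 1")
        case True
        have "sgn (\<sigma> v \<omega>) = \<sigma> v \<omega>" using elim(1) less.prems by fastforce
        then show ?thesis using True elim(1) less.prems by (simp add: noise_def)
      next
        case False
        then obtain m where m: "n = Suc m" "m \<ge> 1" using less.prems by (cases n) auto
        have D: "D m v \<omega> \<in> {1..m}" and u: "u m v \<omega> \<in> in_nbrs E v" and \<xi>: "\<xi> m v \<omega> \<in> {-1, 1}"
          and X: "X (Suc m) v \<omega> = \<xi> m v \<omega> * X (D m v \<omega>) (u m v \<omega>) \<omega>"
          using elim(2) m less.prems by auto
        have "X (D m v \<omega>) (u m v \<omega>) \<omega>
            = traj (D m v \<omega>) (\<lambda>ix. noise ix \<omega>) (D m v \<omega>) (u m v \<omega>)"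
        proof (rule less.IH)
          show "D m v \<omega> < n" "1 \<le> D m v \<omega>" using D m by auto
          show "u m v \<omega> \<in> {1..k}" using u in_nbrs_subset by blast
        qed
        also have "\<dots> = traj m (\<lambda>ix. noise ix \<omega>) (D m v \<omega>) (u m v \<omega>)"
          using D by (subst traj_stable[of "D m v \<omega>" m]) auto
        finally show ?thesis
          using X \<xi> m less.prems by (auto simp: noise_def)
      qed
    qed
    then show ?case by blast
  qed
qed

text \<open>For one fixed outcome with noise \<open>z\<close>: the new step is drift plus martingale
  increment, and the drift, being linear in the history, depends on it only through S_n, as S_n B /
  n.\<close>

lemma walk_Suc:
  assumes eq: "\<And>n v. n \<ge> 1 \<Longrightarrow> v \<in> {1..k} \<Longrightarrow> X n v \<omega> = traj n z n v"
    and n: "n \<ge> 1" and j: "j < k"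
  shows "walk X (Suc n) \<omega> (Suc j) = walk X n \<omega> (Suc j)
    + (\<Sum>i<k. walk X n \<omega> (Suc i) * memory_mat k E p $$ (i, j)) / n
    + (mart (Suc n) (Suc j) z - mart n (Suc j) z)"
proof -
  define c where "c = (2 * p (Suc j) - 1) / card (in_nbrs E (Suc j))"
  have "(\<Sum>i<k. walk X n \<omega> (Suc i) * memory_mat k E p $$ (i, j))
      = (\<Sum>i<k. walk X n \<omega> (Suc i) * (if Suc i \<in> in_nbrs E (Suc j) then c else 0))"
    using j by (intro sum.cong) (auto simp: memory_mat_def c_def in_nbrs_def)
  also have "\<dots> = (\<Sum>i=1..k. walk X n \<omega> i * (if i \<in> in_nbrs E (Suc j) then c else 0))"
    by (rule sum.reindex_bij_witness[of _ "\<lambda>i. i - 1" Suc]) auto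
  also have "\<dots> = (\<Sum>i\<in>in_nbrs E (Suc j). walk X n \<omega> i * c)"
    using in_nbrs_subset by (intro sum.mono_neutral_cong_right) auto
  also have "\<dots> = (\<Sum>i\<in>in_nbrs E (Suc j). (\<Sum>d=1..n. real_of_int (traj n z d i)) * c)"
  proof (intro sum.cong refl)
    fix i assume "i \<in> in_nbrs E (Suc j)"
    then have i: "i \<in> {1..k}" using in_nbrs_subset by blast
    have "X d i \<omega> = traj n z d i" if "d \<in> {1..n}" for d
      using eq[of d i] i that by (simp add: traj_stable[of d n])
    then show "walk X n \<omega> i * c = (\<Sum>d=1..n. real_of_int (traj n z d i)) * c"
      by (simp add: walk_def)
  qed
  also have "\<dots> / n = drift n (Suc j) (traj n z)"
    by (simp add: drift_def sum_distrib_left sum_distrib_right mult_ac flip: c_def)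
  finally have "(\<Sum>i<k. walk X n \<omega> (Suc i) * memory_mat k E p $$ (i, j)) / n
      = drift n (Suc j) (traj n z)" .
  moreover have "walk X (Suc n) \<omega> (Suc j) = walk X n \<omega> (Suc j) + traj (Suc n) z (Suc n) (Suc j)"
    using eq[of "Suc n" "Suc j"] j by (simp add: walk_def)
  moreover have "mart (Suc n) (Suc j) z - mart n (Suc j) z
      = traj (Suc n) z (Suc n) (Suc j) - drift n (Suc j) (traj n z)"
    using n by (simp add: mart_def)
  ultimately show ?thesis by linarith
qed

text \<open>On the almost sure event where every martingale coordinate is O(n^\<gamma>) and
  \<open>X\<close> agrees with \<open>traj\<close>, the deterministic matrix recurrence
  applies.\<close>

lemma AE_walk_bigo:
  assumes \<gamma>: "\<gamma> > 1/2" "\<gamma> > max_Re_eigenvalue (memory_mat k E p)"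
  shows "AE \<omega> in M. \<forall>v\<in>{1..k}. (\<lambda>n. walk X n \<omega> v) \<in> O(\<lambda>n. real n powr \<gamma>)"
proof -
  have "AE \<omega> in M. \<forall>v\<in>{1..k}. (\<lambda>n. mart n v (\<lambda>ix. noise ix \<omega>)) \<in> O(\<lambda>n. real n powr \<gamma>)"
    using \<gamma>(1) by (intro AE_ball_countable' AE_mart_bigo) auto
  then show ?thesis
    using AE_X_eq_traj
  proof eventually_elim
    case (elim \<omega>)
    have "(\<lambda>n. walk X n \<omega> (Suc j)) \<in> O(\<lambda>n. real n powr \<gamma>)" if j: "j < k" for j
    proof (rule bigo_powr_of_matrix_recurrence[where B = "memory_mat k E p" and k = k and j = j
          and S = "\<lambda>n j. walk X n \<omega> (Suc j)"
          and N = "\<lambda>n j. mart n (Suc j) (\<lambda>ix. noise ix \<omega>)"])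
      show "memory_mat k E p \<in> carrier_mat k k" by (simp add: memory_mat_def)
      show "Re x < \<gamma>" if "x \<in> spectrum (map_mat complex_of_real (memory_mat k E p))" for x
        using that \<gamma>(2) spectrum_memory_mat(1)[OF k_ge_1, of E p]
        by (auto simp: max_Re_eigenvalue_def intro: le_less_trans[OF Max_ge])
      show "(\<lambda>n. mart n (Suc i) (\<lambda>ix. noise ix \<omega>)) \<in> O(\<lambda>n. real n powr \<gamma>)" if "i < k" for i
        using elim(1) that by auto
      show "walk X (Suc n) \<omega> (Suc i) = walk X n \<omega> (Suc i)
          + (\<Sum>l<k. walk X n \<omega> (Suc l) * memory_mat k E p $$ (l, i)) / n
          + (mart (Suc n) (Suc i) (\<lambda>ix. noise ix \<omega>) - mart n (Suc i) (\<lambda>ix. noise ix \<omega>))"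
        if "n \<ge> 1" "i < k" for n i
        using elim(2) that by (intro walk_Suc) auto
    qed (rule j)
    moreover have "\<exists>j<k. v = Suc j" if "v \<in> {1..k}" for v
      using that by (intro exI[of _ "v - 1"]) auto
    ultimately show ?case by blast
  qed
qed

end

theorem theorem10:
  fixes M :: "'a measure"
    and k :: nat
    and E :: "(nat \<times> nat) set"
    and p q :: "nat \<Rightarrow> real"
    and \<sigma> :: "nat \<Rightarrow> 'a \<Rightarrow> int"
    and \<xi> :: "nat \<Rightarrow> nat \<Rightarrow> 'a \<Rightarrow> int"
    and D u :: "nat \<Rightarrow> nat \<Rightarrow> 'a \<Rightarrow> nat"
    and X :: "nat \<Rightarrow> nat \<Rightarrow> 'a \<Rightarrow> int"
    and \<delta> :: real
  assumes "erwg M k E p q \<sigma> \<xi> D u X"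
    and "\<delta> > 1/2 - min (1/2) (1 - max_Re_eigenvalue (memory_mat k E p))"
  shows "AE \<omega> in M.
    (\<lambda>n. L2_set (walk X n \<omega>) {1..k}) \<in> o(\<lambda>n. real n powr (1/2 + \<delta>))"
proof -
  interpret erwg M k E p q \<sigma> \<xi> D u X by (rule assms(1))
  \<comment> \<open>The condition on \<delta> says exactly this. An exponent \<gamma> strictly in
    between turns the bound O(n^\<gamma>) into the required little-o.\<close>
  have "max (1/2) (max_Re_eigenvalue (memory_mat k E p)) < 1/2 + \<delta>"
    using assms(2) by linarith
  then obtain \<gamma> where \<gamma>: "1/2 < \<gamma>" "max_Re_eigenvalue (memory_mat k E p) < \<gamma>" "\<gamma> < 1/2 + \<delta>"
    using dense by (metis max_less_iff_conj)
  show ?thesis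
    using AE_walk_bigo[OF \<gamma>(1,2)]
  proof eventually_elim
    case (elim \<omega>)
    \<comment> \<open>The Euclidean norm is at most the sum of absolute values, which reduces the
      claim to coordinates.\<close>
    have "(\<lambda>n. L2_set (walk X n \<omega>) {1..k}) \<in> O(\<lambda>n. \<Sum>v=1..k. \<bar>walk X n \<omega> v\<bar>)"
    proof (intro landau_o.big_mono always_eventually allI)
      show "norm (L2_set (walk X n \<omega>) {1..k}) \<le> norm (\<Sum>v=1..k. \<bar>walk X n \<omega> v\<bar>)" for n
        using L2_set_le_sum_abs[of "walk X n \<omega>" "{1..k}"] by (simp add: sum_nonneg)
    qed
    also have "(\<lambda>n. \<Sum>v=1..k. \<bar>walk X n \<omega> v\<bar>) \<in> O(\<lambda>n. real n powr \<gamma>)"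
      using elim by (intro big_sum_in_bigo) auto
    also have "(\<lambda>n. real n powr \<gamma>) \<in> o(\<lambda>n. real n powr (1/2 + \<delta>))"
      using \<gamma>(3) by real_asymp
    finally show ?case .
  qed
qed

end
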